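(* Let $P$ be a firmly nonexpansive map on a finite-dimensional Euclidean space with a fixed point $z^\star$, let $\|x_0-z^\star\|\le R$, and let $(x_t,y_t)_{t\ge0}$ be the exact Halpern orbit $$y_t=P(x_t),\qquad x_{t+1}=\frac{x_0+(t+1)y_t}{t+2},\qquad t\ge0 .$$ Then for every integer $k\ge2$ and every integer $\ell$ with $k\le\ell\le2k-1$, $$\sum_{t=k}^{\ell}\|y_t-2y_{t-1}+y_{t-2}\|^2\le 64\,\frac{R^2(1+H_{2k})^2}{k^2}.$$
   Context: $P$ is firmly nonexpansive if $\|P(x)-P(y)\|^2+\|(x-P(x))-(y-P(y))\|^2\le\|x-y\|^2$ for all $x,y$. $H_t=\sum_{i=1}^t\frac1i$, $H_0=0$. *)

theory Defs
  imports "HOL-Analysis.Analysis"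
begin

definition firmly_nonexpansive :: "('a::real_inner \<Rightarrow> 'a) \<Rightarrow> bool" where
  "firmly_nonexpansive P \<longleftrightarrow>
     (\<forall>x y. (norm (P x - P y))\<^sup>2 + (norm ((x - P x) - (y - P y)))\<^sup>2 \<le> (norm (x - y))\<^sup>2)"

definition halpern_orbit ::
    "('a::real_vector \<Rightarrow> 'a) \<Rightarrow> (nat \<Rightarrow> 'a) \<Rightarrow> (nat \<Rightarrow> 'a) \<Rightarrow> bool" where
  "halpern_orbit P x y \<longleftrightarrow>
     (\<forall>t. y t = P (x t) \<and>
          x (t + 1) = (x 0 + (real t + 1) *\<^sub>R y t) /\<^sub>R (real t + 2))"

end

theory Submission
  imports Defs
begin

text \<open>
  Write $d_t = y_t - y_{t-1}$ and $u_t = x_t - x_{t-1}$. The Halpern recursion gives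
  $u_t = \frac{t-1}{t}\, d_{t-1} + \frac{y_{t-1} - x_0}{t(t+1)}$. Since $\|d_t\| \le \|u_t\|$ and
  the orbit stays within distance $2R$ of $x_0$, the quantity $t\|u_t\|$ grows at most like $2R H_t$.
  Firm nonexpansiveness also reads $\|d_t\|^2 \le \langle u_t, d_t\rangle$; with
  $u_t = d_{t-1} + e_t$ this becomes
  $\|d_t - d_{t-1}\|^2 \le \|d_{t-1}\|^2 - \|d_t\|^2 + 2\|e_t\|\,\|d_t\|$. The sum telescopes to
  $O(k^{-2})$, and each of the at most $k$ error terms is $O(k^{-3})$, up to squared logarithms.
\<close>

lemma firmly_nonexpansive_norm_le:
  assumes "firmly_nonexpansive P"
  shows "norm (P x - P y) \<le> norm (x - y)"
proof (rule power2_le_imp_le)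
  have "(norm (P x - P y))\<^sup>2 + (norm ((x - P x) - (y - P y)))\<^sup>2 \<le> (norm (x - y))\<^sup>2"
    using assms unfolding firmly_nonexpansive_def by blast
  then show "(norm (P x - P y))\<^sup>2 \<le> (norm (x - y))\<^sup>2"
    using zero_le_power2[of "norm ((x - P x) - (y - P y))"] by linarith
qed simp

text \<open>Regroup the second residual as \<open>(x - y) - (P x - P y)\<close> and expand its
  square: \<open>(norm (x - y))\<^sup>2\<close> cancels, and the rest is twice the claim.\<close>

lemma firmly_nonexpansive_inner:
  assumes "firmly_nonexpansive P"
  shows "(norm (P x - P y))\<^sup>2 \<le> (x - y) \<bullet> (P x - P y)"
proof -
  have "(norm (P x - P y))\<^sup>2 + (norm ((x - y) - (P x - P y)))\<^sup>2 \<le> (norm (x - y))\<^sup>2"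
    using assms unfolding firmly_nonexpansive_def by (simp add: algebra_simps)
  moreover have "(norm ((x - y) - (P x - P y)))\<^sup>2 =
      (norm (x - y))\<^sup>2 + (norm (P x - P y))\<^sup>2 - 2 * ((x - y) \<bullet> (P x - P y))"
    by (simp only: power2_norm_eq_inner inner_diff_left inner_diff_right inner_commute) algebra
  ultimately show ?thesis by linarith
qed

text \<open>In the expansion of the left side the cross term is
  \<open>- 2 * (d' \<bullet> d)\<close>. The assumption bounds it by
  \<open>2 * (e \<bullet> d) - 2 * (norm d)\<^sup>2\<close>, which flips the sign of
  \<open>(norm d)\<^sup>2\<close> and so creates a telescoping difference. Cauchy-Schwarz handles
  \<open>e\<close>.\<close>

lemma power2_norm_diff_le_telescope:
  fixes d d' e :: "'a::real_inner"
  assumes "(norm d)\<^sup>2 \<le> (d' + e) \<bullet> d"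
  shows "(norm (d - d'))\<^sup>2 \<le> (norm d')\<^sup>2 - (norm d)\<^sup>2 + 2 * (norm e * norm d)"
proof -
  have "(norm (d - d'))\<^sup>2 = (norm d)\<^sup>2 + (norm d')\<^sup>2 - 2 * (d' \<bullet> d)"
    by (simp add: power2_norm_eq_inner inner_diff_left inner_diff_right inner_commute)
  moreover have "(d' + e) \<bullet> d \<le> d' \<bullet> d + norm e * norm d"
    using norm_cauchy_schwarz[of e d] by (simp add: inner_add_left)
  ultimately show ?thesis using assms by linarith
qed

lemma halpern_orbit_y: "halpern_orbit P x y \<Longrightarrow> y t = P (x t)"
  by (simp add: halpern_orbit_def)

lemma halpern_orbit_x_Suc:
  assumes "halpern_orbit P x y"
  shows "x (Suc t) = (1 / (real t + 2)) *\<^sub>R x 0 + ((real t + 1) / (real t + 2)) *\<^sub>R y t"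
proof -
  have "x (t + 1) = (x 0 + (real t + 1) *\<^sub>R y t) /\<^sub>R (real t + 2)"
    using assms unfolding halpern_orbit_def by blast
  then show ?thesis by (simp add: scaleR_add_right divide_inverse mult.commute)
qed

text \<open>From one step to the next the anchor \<open>x 0\<close> loses exactly the weight
  1/((t+2)(t+3)). Moving that weight to \<open>y (Suc t)\<close> leaves a plain multiple of the
  output difference.\<close>

lemma halpern_orbit_increment:
  assumes "halpern_orbit P x y"
  shows "x (Suc (Suc t)) - x (Suc t) =
    ((real t + 1) / (real t + 2)) *\<^sub>R (y (Suc t) - y t)
      + (1 / ((real t + 2) * (real t + 3))) *\<^sub>R (y (Suc t) - x 0)"
proof -
  have "1 / (real t + 3) - 1 / (real t + 2) = - (1 / ((real t + 2) * (real t + 3)))"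
    by (simp add: field_simps)
  moreover have "(real t + 2) / (real t + 3) =
      (real t + 1) / (real t + 2) + 1 / ((real t + 2) * (real t + 3))"
    by (simp add: divide_simps) algebra
  moreover have "x (Suc (Suc t)) =
      (1 / (real t + 3)) *\<^sub>R x 0 + ((real t + 2) / (real t + 3)) *\<^sub>R y (Suc t)"
    using halpern_orbit_x_Suc[OF assms, of "Suc t"] by (simp add: add_ac)
  then have "x (Suc (Suc t)) - x (Suc t) =
      (1 / (real t + 3) - 1 / (real t + 2)) *\<^sub>R x 0
        + ((real t + 2) / (real t + 3)) *\<^sub>R y (Suc t) - ((real t + 1) / (real t + 2)) *\<^sub>R y t"
    by (simp add: halpern_orbit_x_Suc[OF assms, of t] algebra_simps)
  ultimately show ?thesis
    by (simp only: scaleR_add_left scaleR_diff_right scaleR_minus_left) simp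
qed

lemma halpern_orbit_norm_y_le:
  assumes "firmly_nonexpansive P" "halpern_orbit P x y"
  shows "norm (y t - y s) \<le> norm (x t - x s)"
  using firmly_nonexpansive_norm_le[OF assms(1), of "x t" "x s"]
  by (simp add: halpern_orbit_y[OF assms(2)])

lemma halpern_orbit_bounded:
  assumes P: "firmly_nonexpansive P" and z: "P z = z" and R: "norm (x 0 - z) \<le> R"
    and orbit: "halpern_orbit P x y"
  shows "norm (x t - z) \<le> R" "norm (y t - z) \<le> R"
proof -
  have y_le: "norm (y t - z) \<le> norm (x t - z)" for t
    using firmly_nonexpansive_norm_le[OF P, of "x t" z] by (simp add: halpern_orbit_y[OF orbit] z)
  \<comment> \<open>Each new iterate is a convex combination of \<open>x 0\<close> and
    \<open>y t\<close>, so it cannot leave a ball that contains both.\<close>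
  have x_in: "x t \<in> cball z R" for t
  proof (induction t)
    case 0
    show ?case using R by (simp add: dist_norm norm_minus_commute)
  next
    case (Suc t)
    have "y t \<in> cball z R"
      using Suc y_le[of t] by (simp add: dist_norm norm_minus_commute)
    moreover have "x 0 \<in> cball z R"
      using R by (simp add: dist_norm norm_minus_commute)
    moreover have "1 / (real t + 2) + (real t + 1) / (real t + 2) = 1"
      by (simp add: divide_simps)
    ultimately show ?case
      unfolding halpern_orbit_x_Suc[OF orbit]
      by (intro convexD[OF convex_cball]) auto
  qed
  then show "norm (x t - z) \<le> R" by (simp add: dist_norm norm_minus_commute)
  with y_le[of t] show "norm (y t - z) \<le> R" by linarith
qed

lemma halpern_orbit_y_dist_start:
  assumes "firmly_nonexpansive P" "P z = z" "norm (x 0 - z) \<le> R" "halpern_orbit P x y"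
  shows "norm (y t - x 0) \<le> 2 * R"
  using halpern_orbit_bounded(2)[OF assms, of t] assms(3)
    norm_triangle_ineq4[of "y t - z" "x 0 - z"] by simp

text \<open>The weight t+1 makes the recursion additive: multiplying the increment formula by t+2
  cancels the denominator of (t+1)/(t+2), so each step adds at most 2R/(t+3) to the weighted
  norm.\<close>

lemma halpern_orbit_increment_bound:
  assumes P: "firmly_nonexpansive P" and z: "P z = z" and R: "norm (x 0 - z) \<le> R"
    and orbit: "halpern_orbit P x y"
  shows "(real t + 1) * norm (x (Suc t) - x t) \<le> 2 * R * harm (Suc t)"
proof (induction t)
  have R0: "0 \<le> R" using R norm_ge_zero order_trans by blast
  note dist = halpern_orbit_y_dist_start[OF P z R orbit]
  case 0
  have "x (Suc 0) - x 0 = (1 / 2) *\<^sub>R (y 0 - x 0)"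
    by (simp add: halpern_orbit_x_Suc[OF orbit, of 0] algebra_simps flip: scaleR_add_left)
  then have "norm (x (Suc 0) - x 0) \<le> R"
    using dist[of 0] by simp
  then show ?case using R0 by (simp add: harm_expand)
next
  have R0: "0 \<le> R" using R norm_ge_zero order_trans by blast
  note dist = halpern_orbit_y_dist_start[OF P z R orbit]
  case (Suc t)
  have "norm (x (Suc (Suc t)) - x (Suc t))
      \<le> (real t + 1) / (real t + 2) * norm (y (Suc t) - y t)
        + 1 / ((real t + 2) * (real t + 3)) * norm (y (Suc t) - x 0)"
    unfolding halpern_orbit_increment[OF orbit] by (rule order_trans[OF norm_triangle_ineq]) simp
  also have "\<dots> \<le> (real t + 1) / (real t + 2) * norm (x (Suc t) - x t)
        + 1 / ((real t + 2) * (real t + 3)) * (2 * R)"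
    using halpern_orbit_norm_y_le[OF P orbit] dist by (intro add_mono mult_left_mono) auto
  finally have "(real t + 2) * norm (x (Suc (Suc t)) - x (Suc t))
      \<le> (real t + 2) * ((real t + 1) / (real t + 2) * norm (x (Suc t) - x t)
        + 1 / ((real t + 2) * (real t + 3)) * (2 * R))"
    by (intro mult_left_mono) auto
  also have "\<dots> = (real t + 1) * norm (x (Suc t) - x t) + 2 * R * (1 / (real t + 3))"
    by (simp add: divide_simps)
  \<comment> \<open>Weakening 1/(t+3) to 1/(t+2) produces exactly the next harmonic summand.\<close>
  also have "\<dots> \<le> 2 * R * harm (Suc t) + 2 * R * (1 / (real t + 2))"
    using R0 Suc.IH by (intro add_mono mult_left_mono) (auto simp: divide_simps)
  also have "\<dots> = 2 * R * harm (Suc (Suc t))"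
    by (simp add: harm_Suc[of "Suc t"] algebra_simps divide_inverse)
  finally show ?case by (simp add: add_ac)
qed

lemma halpern_orbit_output_increment_bound:
  assumes "firmly_nonexpansive P" "P z = z" "norm (x 0 - z) \<le> R" "halpern_orbit P x y"
  shows "norm (y (Suc t) - y t) \<le> 2 * R * harm (Suc t) / (real t + 1)"
proof -
  have "norm (x (Suc t) - x t) \<le> 2 * R * harm (Suc t) / (real t + 1)"
    using halpern_orbit_increment_bound[OF assms, of t] by (simp add: field_simps)
  with halpern_orbit_norm_y_le[OF assms(1,4), of "Suc t" t] show ?thesis by linarith
qed

text \<open>The bound \<open>h\<close> is left free so that one value can serve a whole block of
  indices, which keeps the error constant the same in every term.\<close>

lemma halpern_orbit_second_difference:
  assumes P: "firmly_nonexpansive P" and z: "P z = z" and R: "norm (x 0 - z) \<le> R"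
    and orbit: "halpern_orbit P x y" and h: "harm (Suc (Suc t)) \<le> h"
  shows "(norm (y (Suc (Suc t)) - 2 *\<^sub>R y (Suc t) + y t))\<^sup>2
    \<le> (norm (y (Suc t) - y t))\<^sup>2 - (norm (y (Suc (Suc t)) - y (Suc t)))\<^sup>2
      + 8 * (R\<^sup>2 * (1 + h)\<^sup>2) / ((real t + 1) * (real t + 2)\<^sup>2)"
proof -
  have R0: "0 \<le> R" using R norm_ge_zero order_trans by blast
  have h': "harm (Suc t) \<le> h" by (rule order_trans[OF harm_mono h]) simp
  have h0: "0 \<le> h" using h harm_nonneg[of "Suc (Suc t)"] by (rule order_trans[rotated])
  define d where "d = y (Suc (Suc t)) - y (Suc t)"
  define d' where "d' = y (Suc t) - y t"
  \<comment> \<open>The defect of the input increment from the previous output difference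
    \<open>d'\<close>: the anchor drift, and the 1/(t+2) by which the weight of \<open>d'\<close>
    falls short of 1.\<close>
  define e where "e = (1 / ((real t + 2) * (real t + 3))) *\<^sub>R (y (Suc t) - x 0)
      - (1 / (real t + 2)) *\<^sub>R d'"
  have "(real t + 1) / (real t + 2) = 1 - 1 / (real t + 2)" by (simp add: divide_simps)
  then have u: "x (Suc (Suc t)) - x (Suc t) = d' + e"
    unfolding halpern_orbit_increment[OF orbit] e_def d'_def
    by (simp only: scaleR_diff_left scaleR_one) simp
  have firm: "(norm d)\<^sup>2 \<le> (d' + e) \<bullet> d"
    using firmly_nonexpansive_inner[OF P, of "x (Suc (Suc t))" "x (Suc t)"]
    unfolding u[symmetric] d_def by (simp add: halpern_orbit_y[OF orbit])
  have d'_le: "norm d' \<le> 2 * R * h / (real t + 1)"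
    unfolding d'_def using R0 h'
    by (intro order_trans[OF halpern_orbit_output_increment_bound[OF P z R orbit]]
        divide_right_mono mult_left_mono) auto
  have "norm d \<le> 2 * R * h / (real (Suc t) + 1)"
    unfolding d_def using R0 h
    by (intro order_trans[OF halpern_orbit_output_increment_bound[OF P z R orbit]]
        divide_right_mono mult_left_mono) auto
  also have "\<dots> \<le> 2 * R * (1 + h) / (real t + 2)"
    using R0 by (auto intro!: divide_right_mono mult_left_mono simp: add_ac)
  finally have d_le: "norm d \<le> 2 * R * (1 + h) / (real t + 2)" .
  have "norm e \<le> 1 / ((real t + 2) * (real t + 3)) * norm (y (Suc t) - x 0)
      + 1 / (real t + 2) * norm d'"
    unfolding e_def by (rule order_trans[OF norm_triangle_ineq4]) simp
  \<comment> \<open>With t+3 lowered to t+1 both summands share a denominator. The anchor drift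
    supplies the 1 in \<open>1 + h\<close>, the output difference the \<open>h\<close>.\<close>
  also have "\<dots> \<le> 1 / ((real t + 2) * (real t + 1)) * (2 * R)
      + 1 / (real t + 2) * (2 * R * h / (real t + 1))"
    using halpern_orbit_y_dist_start[OF P z R orbit] d'_le R0
    by (intro add_mono mult_mono mult_left_mono divide_left_mono) auto
  also have "\<dots> = 2 * R * (1 + h) / ((real t + 1) * (real t + 2))"
    by (simp add: divide_simps) algebra
  finally have e_le: "norm e \<le> 2 * R * (1 + h) / ((real t + 1) * (real t + 2))" .
  have "norm e * norm d
      \<le> 2 * R * (1 + h) / ((real t + 1) * (real t + 2)) * (2 * R * (1 + h) / (real t + 2))"
    using e_le d_le R0 h0 by (intro mult_mono) auto
  also have "\<dots> = 4 * (R\<^sup>2 * (1 + h)\<^sup>2) / ((real t + 1) * (real t + 2)\<^sup>2)"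
    by (simp add: power2_eq_square algebra_simps)
  finally have ed: "norm e * norm d \<le> 4 * (R\<^sup>2 * (1 + h)\<^sup>2) / ((real t + 1) * (real t + 2)\<^sup>2)" .
  have "y (Suc (Suc t)) - 2 *\<^sub>R y (Suc t) + y t = d - d'"
    by (simp add: d_def d'_def scaleR_2)
  then show ?thesis
    using power2_norm_diff_le_telescope[OF firm] ed unfolding d_def[symmetric] d'_def[symmetric]
    by simp
qed

theorem lemma6p2:
  fixes P :: "'a::euclidean_space \<Rightarrow> 'a"
    and zstar :: 'a
    and x y :: "nat \<Rightarrow> 'a"
    and R :: real
    and k l :: nat
  assumes "firmly_nonexpansive P"
    and "P zstar = zstar"
    and "norm (x 0 - zstar) \<le> R"
    and "halpern_orbit P x y"
    and "k \<ge> 2"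
    and "k \<le> l" and "l \<le> 2 * k - 1"
  shows "(\<Sum>t=k..l. (norm (y t - 2 *\<^sub>R y (t - 1) + y (t - 2)))\<^sup>2)
           \<le> 64 * (R\<^sup>2 * (1 + harm (2 * k))\<^sup>2 / (real k)\<^sup>2)"
proof -
  define h :: real where "h = harm (2 * k)"
  define K where "K = R\<^sup>2 * (1 + h)\<^sup>2"
  define D where "D t = (norm (y t - y (t - 1)))\<^sup>2" for t
  have R0: "0 \<le> R" using assms(3) norm_ge_zero order_trans by blast
  have h0: "0 \<le> h" unfolding h_def by (rule harm_nonneg)
  have K0: "0 \<le> K" by (simp add: K_def)
  \<comment> \<open>This trades the shifted denominator k-1 for k, at the cost of a factor 2, both
    in the error terms and in \<open>D (k - 1)\<close>.\<close>
  have k_half: "real k / 2 \<le> real k - 1" using assms(5) by simp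
  have h_ge: "harm t \<le> h" if "t \<le> 2 * k" for t
    unfolding h_def using that by (rule harm_mono)
  have term_le: "(norm (y t - 2 *\<^sub>R y (t - 1) + y (t - 2)))\<^sup>2 \<le> D (t - 1) - D t + 16 * K / real k ^ 3"
    if t: "t \<in> {k..l}" for t
  proof -
    \<comment> \<open>Since t is at least 2, the natural-number subtractions \<open>t - 1\<close>
      and \<open>t - 2\<close> are not truncated.\<close>
    obtain s where s: "t = Suc (Suc s)"
      using t assms(5) by (metis atLeastAtMost_iff add_2_eq_Suc le_Suc_ex order_trans)
    \<comment> \<open>Here s+2 = t is at least k, and s+1 is at least k-1, hence at least
      k/2.\<close>
    have "real k / 2 * (real k)\<^sup>2 \<le> (real s + 1) * (real s + 2)\<^sup>2"
      using t s k_half by (intro mult_mono power_mono) auto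
    then have "8 * K / ((real s + 1) * (real s + 2)\<^sup>2) \<le> 8 * K / (real k / 2 * (real k)\<^sup>2)"
      using K0 assms(5) by (intro divide_left_mono) auto
    also have "\<dots> = 16 * K / real k ^ 3" by (simp add: power2_eq_square power3_eq_cube)
    finally have err: "8 * K / ((real s + 1) * (real s + 2)\<^sup>2) \<le> 16 * K / real k ^ 3" .
    have "harm (Suc (Suc s)) \<le> h"
      using t s assms(7) by (intro h_ge) auto
    from halpern_orbit_second_difference[OF assms(1-4) this]
    have "(norm (y t - 2 *\<^sub>R y (t - 1) + y (t - 2)))\<^sup>2
        \<le> D (t - 1) - D t + 8 * K / ((real s + 1) * (real s + 2)\<^sup>2)"
      by (simp add: s K_def D_def)
    with err show ?thesis by linarith
  qed
  have telescope: "(\<Sum>t=k..l. D (t - 1) - D t) = D (k - 1) - D l"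
    using assms(6) by (induction l rule: dec_induct) simp_all
  have "harm (k - 1) \<le> 1 + h"
    by (rule order_trans[OF h_ge]) auto
  then have "2 * R * harm (k - 1) / (real k - 1) \<le> 2 * R * (1 + h) / (real k / 2)"
    using R0 h0 k_half assms(5) by (intro frac_le mult_left_mono) auto
  moreover have "norm (y (k - 1) - y (k - 1 - 1)) \<le> 2 * R * harm (k - 1) / (real k - 1)"
    using halpern_orbit_output_increment_bound[OF assms(1-4), of "k - 2"] assms(5)
    by (auto simp: numeral_2_eq_2 Suc_diff_Suc of_nat_diff)
  ultimately have "D (k - 1) \<le> (2 * R * (1 + h) / (real k / 2))\<^sup>2"
    unfolding D_def by (intro power_mono) auto
  also have "\<dots> = 16 * K / (real k)\<^sup>2"
    by (simp add: K_def power_mult_distrib power_divide)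
  finally have D_le: "D (k - 1) \<le> 16 * K / (real k)\<^sup>2" .
  \<comment> \<open>The upper limit 2k-1 keeps the block to at most k terms, so the errors of size
    16K/k^3 sum to the same order as the boundary term.\<close>
  have card_le: "card {k..l} \<le> k"
    using assms(5,7) by simp
  have "(\<Sum>t=k..l. (norm (y t - 2 *\<^sub>R y (t - 1) + y (t - 2)))\<^sup>2)
      \<le> (\<Sum>t=k..l. D (t - 1) - D t + 16 * K / real k ^ 3)"
    by (rule sum_mono) (rule term_le)
  also have "\<dots> = D (k - 1) - D l + real (card {k..l}) * (16 * K / real k ^ 3)"
    by (simp only: sum.distrib telescope sum_constant)
  also have "\<dots> \<le> 16 * K / (real k)\<^sup>2 - 0 + real k * (16 * K / real k ^ 3)"
    using D_le K0 card_le
    by (intro add_mono diff_mono mult_right_mono) (simp_all add: D_def del: card_atLeastAtMost)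
  \<comment> \<open>The boundary term and the accumulated errors contribute 16 each.\<close>
  also have "\<dots> = 32 * (K / (real k)\<^sup>2)"
    using assms(5) by (simp add: power2_eq_square power3_eq_cube)
  also have "\<dots> \<le> 64 * (K / (real k)\<^sup>2)"
    using K0 by (intro mult_right_mono) auto
  finally show ?thesis unfolding K_def h_def .
qed

end
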